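(* Let $m\geq 3$ and $h\geq 1$ be integers with $(m,h)\notin\{(3,1),(4,1)\}$, let $n=m^h$, and let $\overline{\Gamma_{m^h}}=\overline{C_{m^h}(1,m,m^2,\ldots,m^{h-1})}$ be the complement of the circulant graph $C_{m^h}(1,m,m^2,\ldots,m^{h-1})$. Then its edge-forwarding index satisfies $$\frac{2(n+2h-1)}{n-2h-1}\leq \pi(\overline{\Gamma_{m^h}})\leq 6h+2.$$
   Context: For $S\subseteq\mathbb{Z}_n\setminus\{0\}$, the circulant graph $C_n(S)$ is the simple undirected graph with vertex set $\mathbb{Z}_n=\{0,1,\ldots,n-1\}$ and edge set $\{\{g,g+s\}: g\in\mathbb{Z}_n, s\in S\}$ (addition mod $n$); $C_n(s_1,\ldots,s_t)$ means $C_n(\{s_1,\ldots,s_t\})$. $\overline{\Gamma}$ denotes the complement of $\Gamma$. A routing $R$ of a connected graph $\Gamma$ on $n$ vertices is a set of $n(n-1)$ elementary (i.e. simple) paths $R(x,y)$, one from $x$ to $y$ for every ordered pair $(x,y)$ of distinct vertices. The load of an edge $e$ in $R$ is the number of paths of $R$ passing through $e$ (in either direction), and $\pi(\Gamma,R)$ is the maximum load over all edges of $\Gamma$. The edge-forwarding index is $\pi(\Gamma)=\min_R\pi(\Gamma,R)$, the minimum over all routings $R$ of $\Gamma$. *)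

theory Defs
  imports Complex_Main
begin

text \<open>Simple undirected graphs: edges are two-element subsets of the vertex set.\<close>

record 'v ugraph =
  verts :: "'v set"
  edges :: "'v set set"

definition simple_graph :: "'v ugraph \<Rightarrow> bool" where
  "simple_graph G \<longleftrightarrow> (\<forall>e\<in>edges G. e \<subseteq> verts G \<and> card e = 2)"

definition complement :: "'v ugraph \<Rightarrow> 'v ugraph" where
  "complement G =
     \<lparr> verts = verts G,
       edges = {{x, y} | x y. x \<in> verts G \<and> y \<in> verts G \<and> x \<noteq> y \<and> {x, y} \<notin> edges G} \<rparr>"

text \<open>The residues modulo \<open>n\<close> are represented by the naturals below \<open>n\<close>.  The connection set
  is meant to satisfy \<open>S \<subseteq> {1..<n}\<close>; it need not be closed under negation.\<close>

definition circulant :: "nat \<Rightarrow> nat set \<Rightarrow> nat ugraph" where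
  "circulant n S =
     \<lparr> verts = {0..<n},
       edges = {{g, (g + s) mod n} | g s. g \<in> {0..<n} \<and> s \<in> S} \<rparr>"

lemma simple_graph_complement: "simple_graph (complement G)"
  by (auto simp: simple_graph_def complement_def)

lemma simple_graph_circulant:
  assumes "S \<subseteq> {1..<n}"
  shows "simple_graph (circulant n S)"
proof -
  have "(g + s) mod n \<noteq> g" if "g < n" "s \<in> S" for g s
  proof (cases "g + s < n")
    case True
    then show ?thesis using that assms by auto
  next
    case False
    have "s < n" using that assms by auto
    then have "(g + s) mod n = g + s - n"
      using False that by (simp add: mod_if)
    then show ?thesis using \<open>s < n\<close> False by linarith
  qed
  then show ?thesis
    by (fastforce simp: simple_graph_def circulant_def)
qed

text \<open>A path is given by its list of vertices.\<close>

definition elementary_path :: "'v ugraph \<Rightarrow> 'v \<Rightarrow> 'v list \<Rightarrow> 'v \<Rightarrow> bool" where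
  "elementary_path G x p y \<longleftrightarrow>
     p \<noteq> [] \<and> hd p = x \<and> last p = y \<and> distinct p \<and> set p \<subseteq> verts G \<and>
     (\<forall>i. Suc i < length p \<longrightarrow> {p ! i, p ! Suc i} \<in> edges G)"

definition path_edges :: "'v list \<Rightarrow> 'v set set" where
  "path_edges p = {{p ! i, p ! Suc i} | i. Suc i < length p}"

definition vertex_pairs :: "'v ugraph \<Rightarrow> ('v \<times> 'v) set" where
  "vertex_pairs G = {(x, y). x \<in> verts G \<and> y \<in> verts G \<and> x \<noteq> y}"

text \<open>A routing is a choice function on ordered pairs of distinct vertices; its values at all
  other arguments are irrelevant.  Paths chosen for different pairs have different ends, so
  counting pairs is the same as counting paths.\<close>

definition routing :: "'v ugraph \<Rightarrow> ('v \<Rightarrow> 'v \<Rightarrow> 'v list) \<Rightarrow> bool" where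
  "routing G R \<longleftrightarrow> (\<forall>(x, y)\<in>vertex_pairs G. elementary_path G x (R x y) y)"

definition load :: "'v ugraph \<Rightarrow> ('v \<Rightarrow> 'v \<Rightarrow> 'v list) \<Rightarrow> 'v set \<Rightarrow> nat" where
  "load G R e = card {(x, y) \<in> vertex_pairs G. e \<in> path_edges (R x y)}"

definition max_load :: "'v ugraph \<Rightarrow> ('v \<Rightarrow> 'v \<Rightarrow> 'v list) \<Rightarrow> nat" where
  "max_load G R = Max (load G R ` edges G)"

text \<open>Meaningful for finite connected graphs with at least two vertices, where a routing and an
  edge exist; the infimum is then a minimum by well-ordering of the naturals.\<close>

definition edge_forwarding_index :: "'v ugraph \<Rightarrow> nat" where
  "edge_forwarding_index G = (INF R \<in> {R. routing G R}. max_load G R)"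

lemma edge_forwarding_index_le:
  "routing G R \<Longrightarrow> edge_forwarding_index G \<le> max_load G R"
  unfolding edge_forwarding_index_def by (rule cINF_lower) auto

lemma edge_forwarding_index_attained:
  assumes "routing G R"
  obtains R' where "routing G R'" "max_load G R' = edge_forwarding_index G"
proof -
  have "edge_forwarding_index G \<in> max_load G ` {R. routing G R}"
    unfolding edge_forwarding_index_def using assms by (intro Inf_nat_def1) auto
  then show ?thesis using that by auto
qed

end

theory Submission
  imports Defs
begin

text \<open>
  Write \<open>T = S \<union> -S\<close> for the set of residues that are differences of adjacent vertices of the
  circulant graph, and \<open>t\<close> for its size; here \<open>t = 2 * h\<close>, since \<open>m \<ge> 3\<close> makes the residues
  \<open>\<plusminus>m\<^sup>i\<close> pairwise distinct.  The complement is regular of degree \<open>n - 1 - t\<close>.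

  The lower bound is a double count of the incidences between edges and paths of a routing.
  A path has at least one edge, and at least two if its ends are not adjacent, so the loads
  add up to at least twice the number of ordered pairs minus the number of adjacent ordered pairs
  (\<open>sum_load_lower_bound\<close>); the average load is a lower bound for the maximum.

  For the upper bound, adjacent vertices are joined by their edge, and the other pairs by
  translation-invariant paths of length two: for \<open>s \<in> T\<close> fix a residue \<open>a\<close> such that neither \<open>a\<close>
  nor \<open>s - a\<close> lies in \<open>T \<union> {0}\<close>, and go from \<open>x\<close> to \<open>x + s\<close> through \<open>x + a\<close>.  Such an \<open>a\<close> exists
  once \<open>n > 2 * t\<close>, which holds for the parameters in question (\<open>four_mult_less_power\<close>).
  A path of this kind is determined by \<open>s\<close> and its middle vertex, and if it uses an edge then its
  middle vertex is one of the two ends of that edge.  So at most \<open>2 * t\<close> of these paths and two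
  direct ones use a given edge, and the index is at most \<open>2 * t + 2 = 4 * h + 2\<close>, which is
  below the bound \<open>6 * h + 2\<close> claimed.
\<close>

section \<open>A lower bound for the total load of a routing\<close>

lemma path_edges_subset_edges:
  assumes "elementary_path G x p y"
  shows "path_edges p \<subseteq> edges G"
  using assms unfolding elementary_path_def path_edges_def by auto

lemma finite_path_edges: "finite (path_edges p)"
proof -
  have "path_edges p = (\<lambda>i. {p ! i, p ! Suc i}) ` {i. Suc i < length p}"
    unfolding path_edges_def by auto
  moreover have "finite {i. Suc i < length p}"
    by (rule finite_subset[of _ "{..<length p}"]) auto
  ultimately show ?thesis by simp
qed

text \<open>Stated as a sum so that adding it up over all pairs of ends needs no case distinction.\<close>

lemma card_path_edges_ge:
  assumes p: "elementary_path G x p y" and "x \<noteq> y"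
  shows "2 \<le> card (path_edges p) + (if {x, y} \<in> edges G then 1 else 0)"
proof -
  have ne: "p \<noteq> []" and hd: "p ! 0 = x" and last: "p ! (length p - 1) = y" and d: "distinct p"
    using p unfolding elementary_path_def by (auto simp: hd_conv_nth last_conv_nth)
  have len: "length p \<ge> 2"
  proof (rule ccontr)
    assume "\<not> length p \<ge> 2"
    moreover have "length p \<noteq> 0" using ne by simp
    ultimately have "length p - 1 = 0" by linarith
    then show False using hd last \<open>x \<noteq> y\<close> by simp
  qed
  have e0: "{p ! 0, p ! 1} \<in> path_edges p"
    unfolding path_edges_def using len by force
  show ?thesis
  proof (cases "length p = 2")
    case True
    then have "{x, y} = {p ! 0, p ! 1}" using hd last by simp
    then have "{x, y} \<in> edges G" using e0 path_edges_subset_edges[OF p] by auto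
    moreover have "card (path_edges p) > 0"
      using e0 finite_path_edges by (auto simp: card_gt_0_iff)
    ultimately show ?thesis by simp
  next
    case False
    then have len3: "2 < length p" using len by simp
    have e1: "{p ! 1, p ! 2} \<in> path_edges p"
      unfolding path_edges_def using len3 by (auto intro!: exI[of _ 1] simp: numeral_2_eq_2)
    have "p ! 0 \<noteq> p ! 1" "p ! 0 \<noteq> p ! 2"
      using nth_eq_iff_index_eq[OF d] len3 by force+
    then have "card {{p ! 0, p ! 1}, {p ! 1, p ! 2}} = 2"
      by (auto simp: doubleton_eq_iff)
    moreover have "card {{p ! 0, p ! 1}, {p ! 1, p ! 2}} \<le> card (path_edges p)"
      using e0 e1 finite_path_edges by (intro card_mono) auto
    ultimately show ?thesis by simp
  qed
qed

definition adjacent_pairs :: "'v ugraph \<Rightarrow> ('v \<times> 'v) set" where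
  "adjacent_pairs G = {(x, y) \<in> vertex_pairs G. {x, y} \<in> edges G}"

lemma finite_vertex_pairs: "finite (verts G) \<Longrightarrow> finite (vertex_pairs G)"
  unfolding vertex_pairs_def
  by (rule finite_subset[of _ "verts G \<times> verts G"]) auto

lemma finite_edges:
  assumes "simple_graph G" "finite (verts G)"
  shows "finite (edges G)"
  by (rule finite_subset[of _ "Pow (verts G)"]) (use assms in \<open>auto simp: simple_graph_def\<close>)

lemma card_vertex_pairs:
  assumes "finite (verts G)"
  shows "card (vertex_pairs G) = card (verts G) * (card (verts G) - 1)"
proof -
  have "vertex_pairs G = (SIGMA x:verts G. verts G - {x})"
    unfolding vertex_pairs_def by auto
  then show ?thesis using assms by simp
qed

lemma sum_card_swap:
  assumes "finite A" "finite P"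
  shows "(\<Sum>e\<in>A. card {q \<in> P. r e q}) = (\<Sum>q\<in>P. card {e \<in> A. r e q})"
  using assms by (intro sum_multicount_gen) auto

lemma card_adjacent_pairs:
  assumes G: "simple_graph G" and fin: "finite (verts G)"
  shows "card (adjacent_pairs G) = 2 * card (edges G)"
proof -
  let ?r = "\<lambda>e (x, y). {x, y} = e"
  have fE: "finite (edges G)" by (rule finite_edges[OF G fin])
  have fP: "finite (adjacent_pairs G)"
    by (rule finite_subset[OF _ finite_vertex_pairs[OF fin]]) (auto simp: adjacent_pairs_def)
  have two: "card {q \<in> adjacent_pairs G. ?r e q} = 2" if e: "e \<in> edges G" for e
  proof -
    have "card e = 2" "e \<subseteq> verts G" using G e unfolding simple_graph_def by auto
    then obtain u v where uv: "e = {u, v}" "u \<noteq> v" by (auto simp: card_2_iff)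
    then have "{q \<in> adjacent_pairs G. ?r e q} = {(u, v), (v, u)}"
      using e \<open>e \<subseteq> verts G\<close>
      by (auto simp: adjacent_pairs_def vertex_pairs_def doubleton_eq_iff insert_commute)
    then show ?thesis using uv by simp
  qed
  have one: "card {e \<in> edges G. ?r e q} = 1" if "q \<in> adjacent_pairs G" for q
  proof -
    have "{e \<in> edges G. ?r e q} = {{fst q, snd q}}"
      using that by (auto simp: adjacent_pairs_def)
    then show ?thesis by simp
  qed
  have "(\<Sum>e\<in>edges G. card {q \<in> adjacent_pairs G. ?r e q})
      = (\<Sum>q\<in>adjacent_pairs G. card {e \<in> edges G. ?r e q})"
    by (rule sum_card_swap[OF fE fP])
  then show ?thesis using two one by simp
qed

lemma sum_load_lower_bound:
  assumes G: "simple_graph G" and fin: "finite (verts G)" and R: "routing G R"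
  shows "2 * card (vertex_pairs G) \<le> (\<Sum>e\<in>edges G. load G R e) + card (adjacent_pairs G)"
proof -
  let ?r = "\<lambda>e (x, y). e \<in> path_edges (R x y)"
  let ?adj = "\<lambda>q. if q \<in> adjacent_pairs G then 1 else 0 :: nat"
  note fP = finite_vertex_pairs[OF fin]
  have "(\<Sum>e\<in>edges G. load G R e) = (\<Sum>e\<in>edges G. card {q \<in> vertex_pairs G. ?r e q})"
    unfolding load_def by (intro sum.cong refl arg_cong[where f = card]) auto
  also have "\<dots> = (\<Sum>q\<in>vertex_pairs G. card {e \<in> edges G. ?r e q})"
    by (rule sum_card_swap[OF finite_edges[OF G fin] fP])
  finally have loads: "(\<Sum>e\<in>edges G. load G R e)
      = (\<Sum>q\<in>vertex_pairs G. card {e \<in> edges G. ?r e q})" .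
  have "2 * card (vertex_pairs G) = (\<Sum>q\<in>vertex_pairs G. 2)" by simp
  also have "\<dots> \<le> (\<Sum>q\<in>vertex_pairs G. card {e \<in> edges G. ?r e q} + ?adj q)"
  proof (rule sum_mono)
    fix q assume q: "q \<in> vertex_pairs G"
    obtain x y where xy: "q = (x, y)" by (cases q)
    have path: "elementary_path G x (R x y) y"
      using R q xy unfolding routing_def by auto
    have "{e \<in> edges G. ?r e q} = path_edges (R x y)"
      using path_edges_subset_edges[OF path] xy by auto
    moreover have "q \<in> adjacent_pairs G \<longleftrightarrow> {x, y} \<in> edges G" "x \<noteq> y"
      using q xy by (auto simp: adjacent_pairs_def vertex_pairs_def)
    ultimately show "2 \<le> card {e \<in> edges G. ?r e q} + ?adj q"
      using card_path_edges_ge[OF path] by simp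
  qed
  also have "\<dots> = (\<Sum>e\<in>edges G. load G R e) + (\<Sum>q\<in>vertex_pairs G. ?adj q)"
    unfolding loads by (simp add: sum.distrib)
  also have "(\<Sum>q\<in>vertex_pairs G. ?adj q) = card (vertex_pairs G \<inter> adjacent_pairs G)"
    using fP by (simp add: sum.If_cases)
  also have "vertex_pairs G \<inter> adjacent_pairs G = adjacent_pairs G"
    by (auto simp: adjacent_pairs_def)
  finally show ?thesis .
qed

lemma load_le_max_load:
  assumes "finite (edges G)" "e \<in> edges G"
  shows "load G R e \<le> max_load G R"
  unfolding max_load_def using assms by (intro Max_ge) auto

text \<open>The routing in the hypothesis only certifies that the infimum defining the index is
  attained; the bound comes from an optimal routing.\<close>

lemma edge_forwarding_index_ge:
  assumes G: "simple_graph G" and fin: "finite (verts G)" and R: "routing G R"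
  shows "2 * card (verts G) * (card (verts G) - 1)
      \<le> card (edges G) * (edge_forwarding_index G + 2)"
proof -
  obtain R' where R': "routing G R'" "max_load G R' = edge_forwarding_index G"
    using edge_forwarding_index_attained[OF R] by blast
  have "(\<Sum>e\<in>edges G. load G R' e) \<le> card (edges G) * edge_forwarding_index G"
    using sum_bounded_above[of "edges G" "load G R'" "edge_forwarding_index G"]
      load_le_max_load[OF finite_edges[OF G fin], of _ R'] R'(2) by simp
  then show ?thesis
    using sum_load_lower_bound[OF G fin R'(1)] card_adjacent_pairs[OF G fin]
      card_vertex_pairs[OF fin] by (simp add: algebra_simps)
qed

section \<open>Arithmetic of residues\<close>

text \<open>Addition and subtraction in \<open>{0..<n}\<close> modulo \<open>n\<close>, with the case distinction explicit so that
  identities between them fall to linear arithmetic.\<close>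

definition res_add :: "nat \<Rightarrow> nat \<Rightarrow> nat \<Rightarrow> nat" where
  "res_add n x y = (if x + y < n then x + y else x + y - n)"

definition res_diff :: "nat \<Rightarrow> nat \<Rightarrow> nat \<Rightarrow> nat" where
  "res_diff n y x = (if x \<le> y then y - x else y + n - x)"

lemma mod_eq_res_add: "x < n \<Longrightarrow> y < n \<Longrightarrow> (x + y) mod n = res_add n x y"
  by (simp add: res_add_def mod_if)

lemma res_add_less: "x < n \<Longrightarrow> y < n \<Longrightarrow> res_add n x y < n"
  by (auto simp: res_add_def)

lemma res_diff_less: "x < n \<Longrightarrow> y < n \<Longrightarrow> res_diff n y x < n"
  by (auto simp: res_diff_def)

lemma res_add_diff: "x < n \<Longrightarrow> y < n \<Longrightarrow> res_add n x (res_diff n y x) = y"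
  by (auto simp: res_add_def res_diff_def)

lemma res_diff_add: "x < n \<Longrightarrow> a < n \<Longrightarrow> res_diff n (res_add n x a) x = a"
  by (auto simp: res_add_def res_diff_def)

lemma res_diff_add_right: "x < n \<Longrightarrow> a < n \<Longrightarrow> res_diff n (res_add n x a) a = x"
  by (auto simp: res_add_def res_diff_def)

lemma res_diff_add_add:
  "x < n \<Longrightarrow> a < n \<Longrightarrow> y < n \<Longrightarrow>
    res_diff n y (res_add n x a) = res_diff n (res_diff n y x) a"
  by (auto simp: res_add_def res_diff_def)

lemma res_diff_diff: "s < n \<Longrightarrow> a < n \<Longrightarrow> res_diff n s (res_diff n s a) = a"
  by (auto simp: res_diff_def)

lemma res_diff_eq_0_iff: "x < n \<Longrightarrow> y < n \<Longrightarrow> res_diff n y x = 0 \<longleftrightarrow> x = y"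
  by (auto simp: res_diff_def)

lemma res_diff_swap:
  "x < n \<Longrightarrow> y < n \<Longrightarrow> x \<noteq> y \<Longrightarrow> res_diff n x y = n - res_diff n y x"
  by (auto simp: res_diff_def)

section \<open>The complement of a circulant graph\<close>

locale circulant_complement =
  fixes n :: nat and S :: "nat set"
  assumes S_subset: "S \<subseteq> {1..<n}"
begin

definition T :: "nat set" where
  "T = S \<union> (\<lambda>s. n - s) ` S"

definition G :: "nat ugraph" where
  "G = complement (circulant n S)"

lemma T_subset: "T \<subseteq> {1..<n}"
  using S_subset unfolding T_def by fastforce

lemma finite_T: "finite T"
  by (rule finite_subset[OF T_subset]) simp

lemma T_less: "s \<in> T \<Longrightarrow> s < n"
  using T_subset by auto

lemma circulant_edge_iff:
  assumes "x < n" "y < n"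
  shows "{x, y} \<in> edges (circulant n S) \<longleftrightarrow> res_diff n y x \<in> T"
proof
  assume "{x, y} \<in> edges (circulant n S)"
  then obtain g s where gs: "{x, y} = {g, (g + s) mod n}" "g < n" "s \<in> S"
    unfolding circulant_def by auto
  then have s: "1 \<le> s" "s < n" using S_subset by auto
  have y': "(g + s) mod n = res_add n g s" using gs s by (simp add: mod_eq_res_add)
  show "res_diff n y x \<in> T"
  proof (cases "x = g")
    case True
    then have "y = res_add n g s" using gs(1) y' by (auto simp: doubleton_eq_iff)
    then have "res_diff n y x = s" using True gs s by (simp add: res_diff_add)
    then show ?thesis using gs unfolding T_def by simp
  next
    case False
    then have "y = g" "x = res_add n g s" using gs(1) y' by (auto simp: doubleton_eq_iff)
    then have "res_diff n x y = s" using gs s by (simp add: res_diff_add)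
    then have "res_diff n y x = n - s"
      using res_diff_swap[of y n x] assms False \<open>y = g\<close> by simp
    then show ?thesis using gs unfolding T_def by auto
  qed
next
  assume "res_diff n y x \<in> T"
  then consider "res_diff n y x \<in> S" | s where "s \<in> S" "res_diff n y x = n - s"
    unfolding T_def by auto
  then show "{x, y} \<in> edges (circulant n S)"
  proof cases
    case 1
    have "(x + res_diff n y x) mod n = y"
      using assms by (simp add: mod_eq_res_add res_add_diff res_diff_less)
    then have "{x, y} = {x, (x + res_diff n y x) mod n}" by simp
    then show ?thesis using 1 assms unfolding circulant_def by auto
  next
    case (2 s)
    then have s: "1 \<le> s" "s < n" using S_subset by auto
    then have "x \<noteq> y" using 2 by (auto simp: res_diff_def)
    then have "res_diff n x y = s"
      using res_diff_swap[of x n y] 2 s assms by simp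
    then have "(y + s) mod n = x"
      using assms s res_add_diff[of y n x] by (simp add: mod_eq_res_add)
    then have "{x, y} = {y, (y + s) mod n}" by auto
    then show ?thesis using 2 assms unfolding circulant_def by auto
  qed
qed

lemma verts_G: "verts G = {0..<n}"
  unfolding G_def complement_def circulant_def by simp

lemma simple_graph_G: "simple_graph G"
  unfolding G_def by (rule simple_graph_complement)

lemma finite_edges_G: "finite (edges G)"
  by (rule finite_edges[OF simple_graph_G]) (simp add: verts_G)

lemma edge_iff:
  assumes "x < n" "y < n"
  shows "{x, y} \<in> edges G \<longleftrightarrow> res_diff n y x \<notin> insert 0 T"
proof -
  have "{x, y} \<in> edges G \<longleftrightarrow> x \<noteq> y \<and> {x, y} \<notin> edges (circulant n S)"
    using assms unfolding G_def complement_def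
    by (auto simp: circulant_def doubleton_eq_iff insert_commute)
  then show ?thesis
    using circulant_edge_iff[OF assms] res_diff_eq_0_iff[OF assms] by simp
qed

text \<open>A vertex \<open>x\<close> is joined exactly to the \<open>x + d\<close> with \<open>d \<notin> T \<union> {0}\<close>.\<close>

lemma card_edges_G:
  assumes "card T < n"
  shows "2 * card (edges G) = n * (n - 1 - card T)"
proof -
  let ?D = "{1..<n} - T"
  have "bij_betw (\<lambda>(x, d). (x, res_add n x d)) ({0..<n} \<times> ?D) (adjacent_pairs G)"
  proof (rule bij_betw_byWitness[where f' = "\<lambda>(x, y). (x, res_diff n y x)"])
    show "(\<lambda>(x, d). (x, res_add n x d)) ` ({0..<n} \<times> ?D) \<subseteq> adjacent_pairs G"
      by (auto simp: adjacent_pairs_def vertex_pairs_def verts_G edge_iff res_add_less res_diff_add)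
        (auto simp: res_add_def split: if_splits)
    show "(\<lambda>(x, y). (x, res_diff n y x)) ` adjacent_pairs G \<subseteq> {0..<n} \<times> ?D"
      by (auto simp: adjacent_pairs_def vertex_pairs_def verts_G edge_iff res_diff_less
          Suc_le_eq)
  qed (auto simp: adjacent_pairs_def vertex_pairs_def verts_G res_diff_add res_add_diff)
  then have "card (adjacent_pairs G) = card ({0..<n} \<times> ?D)"
    by (simp add: bij_betw_same_card)
  also have "\<dots> = n * (n - 1 - card T)"
    using T_subset finite_T by (simp add: card_Diff_subset)
  finally show ?thesis
    using card_adjacent_pairs[OF simple_graph_G] by (simp add: verts_G)
qed

text \<open>The residues that fail to be detours are those of \<open>U = T \<union> {0}\<close> and of \<open>s - U\<close>.  Both of
  these sets have \<open>card T + 1\<close> elements and both contain \<open>0\<close> and \<open>s\<close>, so together they have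
  at most \<open>2 * card T\<close>.\<close>

lemma detour_exists:
  assumes "s \<in> T" and large: "2 * card T < n"
  shows "\<exists>a<n. a \<notin> insert 0 T \<and> res_diff n s a \<notin> insert 0 T"
proof -
  let ?B = "{0, s} \<union> (T - {s}) \<union> res_diff n s ` (T - {s})"
  have "card ?B \<le> card ({0, s} \<union> (T - {s})) + card (res_diff n s ` (T - {s}))"
    by (rule card_Un_le)
  also have "\<dots> \<le> (card {0, s} + card (T - {s})) + card (T - {s})"
    using finite_T by (intro add_mono card_Un_le card_image_le) auto
  also have "\<dots> \<le> 2 + 2 * card (T - {s})"
    by (simp add: card_insert_if)
  also have "\<dots> = 2 * card T"
    using card_Suc_Diff1[OF finite_T \<open>s \<in> T\<close>] by simp
  finally have "card ?B < card {0..<n}" using large by simp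
  moreover have "finite ?B" using finite_T by simp
  ultimately have "\<not> {0..<n} \<subseteq> ?B" using card_mono[of ?B "{0..<n}"] by linarith
  then obtain a where a: "a < n" "a \<notin> ?B"
    unfolding subset_iff atLeastLessThan_iff by blast
  have s: "s < n" using \<open>s \<in> T\<close> by (rule T_less)
  have "res_diff n s a \<notin> T - {s}"
    using a res_diff_diff[OF s a(1)] by (metis UnI2 imageI)
  moreover have "res_diff n s a \<noteq> s"
    using a res_diff_diff[OF s a(1)] by (auto simp: res_diff_def)
  moreover have "res_diff n s a \<noteq> 0"
    using a s by (auto simp: res_diff_eq_0_iff)
  ultimately show ?thesis using a by auto
qed

definition detour :: "nat \<Rightarrow> nat" where
  "detour s = (SOME a. a < n \<and> a \<notin> insert 0 T \<and> res_diff n s a \<notin> insert 0 T)"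

lemma detour:
  assumes "s \<in> T" "2 * card T < n"
  shows "detour s < n" "detour s \<notin> insert 0 T" "res_diff n s (detour s) \<notin> insert 0 T"
  using someI_ex[of "\<lambda>a. a < n \<and> a \<notin> insert 0 T \<and> res_diff n s a \<notin> insert 0 T",
      OF detour_exists[OF assms]]
  unfolding detour_def by blast+

definition detour_routing :: "nat \<Rightarrow> nat \<Rightarrow> nat list" where
  "detour_routing x y =
     (let s = res_diff n y x in if s \<in> T then [x, res_add n x (detour s), y] else [x, y])"

lemma routing_detour_routing:
  assumes large: "2 * card T < n"
  shows "routing G detour_routing"
  unfolding routing_def
proof clarify
  fix x y assume "(x, y) \<in> vertex_pairs G"
  then have xy: "x < n" "y < n" "x \<noteq> y" by (auto simp: vertex_pairs_def verts_G)
  define s where "s = res_diff n y x"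
  show "elementary_path G x (detour_routing x y) y"
  proof (cases "s \<in> T")
    case True
    define z where "z = res_add n x (detour s)"
    note a = detour[OF True large]
    have z: "z < n" unfolding z_def using xy a by (simp add: res_add_less)
    have "res_diff n z x \<notin> insert 0 T"
      unfolding z_def using xy a by (simp add: res_diff_add)
    then have xz: "{x, z} \<in> edges G" using edge_iff xy z by blast
    have "res_diff n y z \<notin> insert 0 T"
      unfolding z_def using xy a by (simp add: res_diff_add_add s_def)
    then have zy: "{z, y} \<in> edges G" using edge_iff xy z by blast
    have "x \<noteq> z" "z \<noteq> y"
      using xz zy simple_graph_G unfolding simple_graph_def by fastforce+
    moreover have "detour_routing x y = [x, z, y]"
      using True by (simp add: detour_routing_def s_def z_def)
    ultimately show ?thesis
      using xy z xz zy by (auto simp: elementary_path_def verts_G less_Suc_eq)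
  next
    case False
    have "s \<noteq> 0" using xy by (simp add: s_def res_diff_eq_0_iff)
    then have "{x, y} \<in> edges G" using edge_iff[of x y] xy False by (simp add: s_def)
    moreover have "detour_routing x y = [x, y]"
      using False by (simp add: detour_routing_def s_def)
    ultimately show ?thesis
      using xy by (auto simp: elementary_path_def verts_G)
  qed
qed

lemma path_edges_two: "path_edges [x, y] = {{x, y}}"
  unfolding path_edges_def by auto

lemma path_edges_three: "path_edges [x, z, y] = {{x, z}, {z, y}}"
proof -
  have "{i. Suc i < length [x, z, y]} = {0, 1}" by auto
  then show ?thesis unfolding path_edges_def setcompr_eq_image by simp
qed

text \<open>The middle vertex \<open>z\<close> of a path of length two lies on each of its edges, and it gives back
  the whole path once the difference \<open>s\<close> of the ends is known: the path starts at \<open>z - a\<close>, where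
  \<open>a\<close> is the detour for \<open>s\<close>.  Hence \<open>T \<times> e\<close> indexes the detours through the edge \<open>e\<close>.\<close>

lemma load_detour_routing_le:
  assumes large: "2 * card T < n" and e: "e \<in> edges G"
  shows "load G detour_routing e \<le> 2 * card T + 2"
proof -
  have "card e = 2" "e \<subseteq> verts G"
    using e simple_graph_G unfolding simple_graph_def by auto
  then obtain u v where uv: "e = {u, v}" "u \<noteq> v" by (auto simp: card_2_iff)
  have fin: "finite e" using uv by simp
  let ?f = "\<lambda>(s, z). let x = res_diff n z (detour s) in (x, res_add n x s)"
  have "{(x, y) \<in> vertex_pairs G. e \<in> path_edges (detour_routing x y)}
      \<subseteq> {(u, v), (v, u)} \<union> ?f ` (T \<times> e)"
  proof (rule subrelI)
    fix x y
    assume "(x, y) \<in> {(x, y) \<in> vertex_pairs G. e \<in> path_edges (detour_routing x y)}"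
    then have xy: "x < n" "y < n" and p: "e \<in> path_edges (detour_routing x y)"
      by (auto simp: vertex_pairs_def verts_G)
    define s where "s = res_diff n y x"
    show "(x, y) \<in> {(u, v), (v, u)} \<union> ?f ` (T \<times> e)"
    proof (cases "s \<in> T")
      case True
      define z where "z = res_add n x (detour s)"
      have "e = {x, z} \<or> e = {z, y}"
        using p True by (simp add: detour_routing_def s_def z_def path_edges_three)
      then have "(s, z) \<in> T \<times> e" using True by auto
      moreover have "res_diff n z (detour s) = x"
        unfolding z_def using xy detour(1)[OF True large] by (simp add: res_diff_add_right)
      then have "(x, y) = ?f (s, z)"
        using xy by (simp add: s_def res_add_diff)
      ultimately show ?thesis
        using image_eqI[of "(x, y)" ?f "(s, z)" "T \<times> e"] by blast
    next
      case False
      then have "e = {x, y}"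
        using p by (simp add: detour_routing_def s_def path_edges_two)
      then show ?thesis
        using uv by (auto simp: doubleton_eq_iff)
    qed
  qed
  then have "load G detour_routing e \<le> card ({(u, v), (v, u)} \<union> ?f ` (T \<times> e))"
    unfolding load_def using finite_T fin by (intro card_mono) auto
  also have "\<dots> \<le> card {(u, v), (v, u)} + card (?f ` (T \<times> e))"
    by (rule card_Un_le)
  also have "\<dots> \<le> 2 + card (T \<times> e)"
    using finite_T fin uv by (intro add_mono card_image_le) auto
  also have "\<dots> = 2 * card T + 2"
    using \<open>card e = 2\<close> by (simp add: card_cartesian_product)
  finally show ?thesis .
qed

theorem edge_forwarding_index_G_le:
  assumes large: "2 * card T < n" and "S \<noteq> {}"
  shows "edge_forwarding_index G \<le> 2 * card T + 2"
proof -
  have "card T > 0" using finite_T \<open>S \<noteq> {}\<close> by (auto simp: card_gt_0_iff T_def)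
  then have "n * (n - 1 - card T) > 0" using large by simp
  then have "edges G \<noteq> {}" using card_edges_G large by auto
  then have "max_load G detour_routing \<le> 2 * card T + 2"
    unfolding max_load_def
    using finite_edges_G load_detour_routing_le[OF large] by simp
  then show ?thesis
    using edge_forwarding_index_le[OF routing_detour_routing[OF large]] by linarith
qed

theorem edge_forwarding_index_G_ge:
  assumes large: "2 * card T < n" and "S \<noteq> {}"
  shows "2 * (real n + real (card T) - 1) / (real n - real (card T) - 1)
    \<le> real (edge_forwarding_index G)"
proof -
  let ?\<pi> = "edge_forwarding_index G"
  have "card T > 0" using finite_T \<open>S \<noteq> {}\<close> by (auto simp: card_gt_0_iff T_def)
  then have n: "card T + 1 < n" using large by linarith
  have "2 * n * (n - 1) \<le> card (edges G) * (?\<pi> + 2)"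
    using edge_forwarding_index_ge[OF simple_graph_G _ routing_detour_routing[OF large]]
    by (simp add: verts_G)
  then have "2 * (2 * n * (n - 1)) \<le> (2 * card (edges G)) * (?\<pi> + 2)" by linarith
  also have "\<dots> = n * ((n - 1 - card T) * (?\<pi> + 2))"
    using card_edges_G n by (simp only: mult.assoc)
  finally have "n * (4 * (n - 1)) \<le> n * ((n - 1 - card T) * (?\<pi> + 2))"
    by (simp add: algebra_simps)
  then have "4 * (n - 1) \<le> (n - 1 - card T) * (?\<pi> + 2)"
    using n by (simp only: mult_le_cancel1)
  moreover have casts: "real (n - 1) = real n - 1"
      "real (n - 1 - card T) = real n - 1 - real (card T)"
    using n by (simp_all add: of_nat_diff)
  ultimately have "real (4 * (n - 1)) \<le> real ((n - 1 - card T) * (?\<pi> + 2))"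
    by (intro of_nat_mono)
  then have "4 * (real n - 1) \<le> (real n - 1 - real (card T)) * (real ?\<pi> + 2)"
    unfolding of_nat_mult of_nat_add of_nat_numeral casts .
  moreover have "real n - real (card T) - 1 > 0" using n by linarith
  ultimately show ?thesis by (simp add: divide_le_eq algebra_simps)
qed

end

section \<open>Powers of \<open>m\<close> as connection set\<close>

text \<open>The excluded pairs \<open>(3, 1)\<close> and \<open>(4, 1)\<close> are the only ones with \<open>m \<ge> 3\<close> for which this fails.\<close>

lemma four_mult_less_power:
  fixes m h :: nat
  assumes "m \<ge> 3" "h \<ge> 1" "(m, h) \<notin> {(3, 1), (4, 1)}"
  shows "4 * h < m ^ h"
proof (cases "h = 1")
  case True
  then show ?thesis using assms by auto
next
  case False
  then have "2 \<le> h" using assms by simp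
  then have "4 * h < 3 ^ h"
    by (induction h rule: dec_induct) (auto simp: power2_eq_square)
  also have "(3::nat) ^ h \<le> m ^ h" using assms by (intro power_mono) auto
  finally show ?thesis .
qed

text \<open>So \<open>m\<^sup>i\<close> is never \<open>-m\<^sup>j\<close> modulo \<open>m\<^sup>h\<close>, and negation doubles the connection set.  This is
  where \<open>m \<ge> 3\<close> matters: for \<open>m = 2\<close> the residue \<open>m\<^sup>h\<^sup>-\<^sup>1\<close> is its own negative.\<close>

lemma power_add_power_less:
  fixes m h :: nat
  assumes "m \<ge> 3" "i < h" "j < h"
  shows "m ^ i + m ^ j < m ^ h"
proof -
  have "m ^ i \<le> m ^ (h - 1)" "m ^ j \<le> m ^ (h - 1)"
    using assms by (auto intro!: power_increasing)
  moreover have "m ^ h = m * m ^ (h - 1)"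
    using assms by (cases h) auto
  moreover have "3 * m ^ (h - 1) \<le> m * m ^ (h - 1)" using assms by (intro mult_right_mono) auto
  moreover have "m ^ (h - 1) > 0" using assms by simp
  ultimately show ?thesis by linarith
qed

theorem corollary5p8:
  fixes m h n :: nat
  assumes "m \<ge> 3" and "h \<ge> 1"
    and "(m, h) \<notin> {(3, 1), (4, 1)}"
    and "n = m ^ h"
  shows "2 * (real n + 2 * real h - 1) / (real n - 2 * real h - 1)
           \<le> real (edge_forwarding_index (complement (circulant n ((\<lambda>i. m ^ i) ` {0..<h}))))
       \<and> edge_forwarding_index (complement (circulant n ((\<lambda>i. m ^ i) ` {0..<h}))) \<le> 6 * h + 2"
proof -
  let ?S = "(\<lambda>i. m ^ i) ` {0..<h}"
  have S: "?S \<subseteq> {1..<n}" using assms by (auto simp: Suc_le_eq)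
  interpret circulant_complement n ?S using S by unfold_locales
  have "inj_on (\<lambda>i. m ^ i) {0..<h}" using assms by (auto intro!: inj_onI)
  then have card_S: "card ?S = h" by (simp add: card_image)
  have "inj_on (\<lambda>s. n - s) {1..<n}" by (auto intro!: inj_onI)
  then have "inj_on (\<lambda>s. n - s) ?S" using S by (rule inj_on_subset)
  then have card_neg: "card ((\<lambda>s. n - s) ` ?S) = h" using card_S by (simp add: card_image)
  have "?S \<inter> (\<lambda>s. n - s) ` ?S = {}"
  proof -
    have "m ^ i \<noteq> n - m ^ j" if "i < h" "j < h" for i j
      using power_add_power_less[of m i h j] assms that by linarith
    then show ?thesis by auto
  qed
  then have card_T: "card T = 2 * h"
    unfolding T_def using card_S card_neg by (simp add: card_Un_disjoint)
  have large: "2 * card T < n"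
    using four_mult_less_power[of m h] assms card_T by simp
  have "?S \<noteq> {}" using assms by auto
  show ?thesis
    using edge_forwarding_index_G_le[OF large \<open>?S \<noteq> {}\<close>]
      edge_forwarding_index_G_ge[OF large \<open>?S \<noteq> {}\<close>] card_T
    by (simp add: G_def)
qed

end
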